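(* For all $n\in\mathbb{N}$, $$\mu(n)\leq f(n)+3f\left(\frac{f(n)-2}{3}\right).$$
   Context: $\mathbb{N}=\{1,2,3,\ldots\}$ and $\mathbb{N}_0=\{0,1,2,\ldots\}$. Let $T\subseteq\mathbb{N}_0^2$ be the additive monoid consisting of all finite linear combinations with coefficients in $\mathbb{N}_0$ of the vectors $z_i=\left(i,\binom{i}{2}\right)$, $i\in\mathbb{N}_0$, where $\binom{i}{2}=\frac{i(i-1)}{2}$. For $n\in\mathbb{N}_0$, $\mu(n):=\min\{m\in\mathbb{N}_0 : (m,n)\in T\}$. The function $f$ is given by $f(x)=\frac{1+\sqrt{8x+1}}{2}$ for real $x\geq 0$. *)

theory Defs
  imports Complex_Main "HOL-Library.Product_Plus"
begin

definition z :: "nat \<Rightarrow> nat \<times> nat" where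
  "z i = (i, i choose 2)"

text \<open>The type of pairs of naturals is an additive monoid, but has no scalar
  multiplication; the multiple of a vector by a natural number is taken componentwise.\<close>

definition nsmult :: "nat \<Rightarrow> nat \<times> nat \<Rightarrow> nat \<times> nat" where
  "nsmult c v = (c * fst v, c * snd v)"

definition T :: "(nat \<times> nat) set" where
  "T = {\<Sum>i\<in>I. nsmult (c i) (z i) | I c. finite I}"

definition \<mu> :: "nat \<Rightarrow> nat" where
  "\<mu> n = (LEAST m. (m, n) \<in> T)"

text \<open>The minimum is taken over a nonempty set, so \<open>LEAST\<close> is the actual minimum.\<close>

lemma ex_in_T: "\<exists>m. (m, n) \<in> T"
proof -
  have "(2 * n, n) = (\<Sum>i\<in>{2}. nsmult n (z i))"
    by (simp add: nsmult_def z_def)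
  then have "(2 * n, n) \<in> T"
    unfolding T_def by (intro CollectI exI[of _ "{2}"] exI[of _ "\<lambda>_. n"]) simp
  then show ?thesis ..
qed

lemma \<mu>_in_T: "(\<mu> n, n) \<in> T"
  unfolding \<mu>_def using ex_in_T by (rule LeastI_ex)

lemma \<mu>_le: "(m, n) \<in> T \<Longrightarrow> \<mu> n \<le> m"
  unfolding \<mu>_def by (rule Least_le)

text \<open>Only the values at \<open>x \<ge> 0\<close> are meaningful. For \<open>n \<ge> 1\<close> one has
  \<open>f n \<ge> 2\<close>, so the nested argument \<open>(f n - 2) / 3\<close> is nonnegative.\<close>

definition f :: "real \<Rightarrow> real" where
  "f x = (1 + sqrt (8 * x + 1)) / 2"

end

theory Submission imports Defs begin

text \<open>Let \<open>i\<close> be maximal with \<open>i choose 2 \<le> n\<close> and \<open>r = n - (i choose 2) < i\<close>. Since \<open>f\<close> inverts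
  \<open>x \<mapsto> x (x - 1) / 2\<close>, the theorem follows from \<open>\<mu> n \<le> i + \<mu> r\<close>, from \<open>\<mu> r \<le> 3 f (r / 3)\<close>
  and from a comparison of \<open>i\<close> and \<open>r\<close> with \<open>f n\<close>. The bound on \<open>\<mu> r\<close> is
  what concavity gives for a sum of three triangular numbers, but Gauss's theorem that
  every natural number is such a sum is not needed: the same greedy step
  propagates the bound by induction as soon as \<open>i \<ge> 9\<close>, so only the numbers below \<open>36\<close>
  have to be written as sums of three triangular numbers.\<close>

lemma T_zero: "(0, 0) \<in> T"
  unfolding T_def by (intro CollectI exI[of _ "{}"]) (simp add: zero_prod_def)

lemma T_add_z:
  assumes "(m, n) \<in> T"
  shows "(i + m, (i choose 2) + n) \<in> T"
proof -
  obtain I c where I: "finite I" and mn: "(m, n) = (\<Sum>j\<in>I. nsmult (c j) (z j))"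
    using assms unfolding T_def by blast
  \<comment> \<open>The values of \<open>c\<close> outside \<open>I\<close> are arbitrary, so they
    are reset to 0 before the coefficient of \<open>z i\<close> is raised by one.\<close>
  define d where "d j = (if j \<in> I then c j else 0) + (if j = i then 1 else 0)" for j
  have split: "nsmult (d j) (z j) =
      (if j = i then z i else 0) + (if j \<in> I then nsmult (c j) (z j) else 0)" for j
    by (auto simp: d_def nsmult_def z_def zero_prod_def)
  have "(\<Sum>j\<in>insert i I. nsmult (d j) (z j)) =
      z i + (\<Sum>j\<in>insert i I. if j \<in> I then nsmult (c j) (z j) else 0)"
    using I by (simp add: split sum.distrib)
  also have "(\<Sum>j\<in>insert i I. if j \<in> I then nsmult (c j) (z j) else 0) = (m, n)"
    unfolding mn using I by (intro sum.mono_neutral_cong_right) auto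
  finally have "(i + m, (i choose 2) + n) = (\<Sum>j\<in>insert i I. nsmult (d j) (z j))"
    by (simp add: z_def)
  then show ?thesis
    unfolding T_def using I by blast
qed

lemma \<mu>_choose_add_le: "\<mu> ((i choose 2) + n) \<le> i + \<mu> n"
  by (intro \<mu>_le T_add_z \<mu>_in_T)

lemma \<mu>_three_choose_le: "\<mu> ((a choose 2) + (b choose 2) + (c choose 2)) \<le> a + b + c"
  using T_add_z[OF T_add_z[OF T_add_z[OF T_zero]], of a b c]
  by (intro \<mu>_le) (simp add: add.assoc)

lemma real_choose_two: "real (a choose 2) = real a * (real a - 1) / 2"
  by (cases a) (simp_all add: choose_two real_of_nat_div algebra_simps)

lemma f_mono: "x \<le> y \<Longrightarrow> f x \<le> f y"
  by (simp add: f_def)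

lemma le_f: "y * (y - 1) \<le> 2 * x \<Longrightarrow> y \<le> f x"
  using real_le_rsqrt[of "2 * y - 1" "8 * x + 1"]
  by (simp add: f_def power2_eq_square algebra_simps)

lemma three_f_third: "3 * f (x / 3) = (3 + sqrt (24 * x + 9)) / 2"
proof -
  have "sqrt (24 * x + 9) = sqrt (9 * (8 * (x / 3) + 1))"
    by simp
  also have "\<dots> = 3 * sqrt (8 * (x / 3) + 1)"
    by (simp only: real_sqrt_mult) simp
  finally show ?thesis
    by (simp add: f_def)
qed

lemma \<mu>_le_if_three_choose:
  assumes "n = (a choose 2) + (b choose 2) + (c choose 2)"
  shows "real (\<mu> n) \<le> 3 * f (real n / 3)"
proof -
  \<comment> \<open>Four times this sum is the gap between the two sides of the next
    inequality.\<close>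
  have "0 \<le> (real a - real b)\<^sup>2 + (real b - real c)\<^sup>2 + (real a - real c)\<^sup>2"
    by simp
  then have "(2 * (real a + real b + real c) - 3)\<^sup>2 \<le> 24 * real n + 9"
    unfolding assms of_nat_add real_choose_two by (simp add: power2_eq_square field_simps)
  then have "2 * (real a + real b + real c) - 3 \<le> sqrt (24 * real n + 9)"
    by (rule real_le_rsqrt)
  moreover have "real (\<mu> n) \<le> real a + real b + real c"
    using \<mu>_three_choose_le[of a b c] unfolding assms by linarith
  ultimately show ?thesis
    unfolding three_f_third by (simp add: field_simps)
qed

lemma ex_choose_two_add: "\<exists>i r. r < i \<and> n = (i choose 2) + r"
proof (induction n)
  case 0
  show ?case by (intro exI[of _ 1] exI[of _ 0]) simp
next
  case (Suc n)
  then obtain i r where "r < i" "n = (i choose 2) + r" by blast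
  \<comment> \<open>A remainder that reaches \<open>i\<close> is absorbed by Pascal's rule.\<close>
  then have "Suc r < i \<and> Suc n = (i choose 2) + Suc r \<or>
      0 < Suc i \<and> Suc n = (Suc i choose 2) + 0"
    by (auto simp: numeral_2_eq_2)
  then show ?case by blast
qed

lemma ex_three_choose_less_36:
  assumes "n < 36"
  shows "\<exists>a b c. n = (a choose 2) + (b choose 2) + (c choose 2)"
proof -
  \<comment> \<open>Since 36 is \<open>9 choose 2\<close>, indices below 9 give every triangular
    number below 36.\<close>
  have "\<forall>n\<in>set [0..<36]. \<exists>a\<in>set [0..<9]. \<exists>b\<in>set [0..<9]. \<exists>c\<in>set [0..<9].
      n = a * (a - 1) div 2 + b * (b - 1) div 2 + c * (c - 1) div (2 :: nat)"
    by code_simp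
  then show ?thesis
    unfolding choose_two using assms by fastforce
qed

lemma \<mu>_le_three_f_third: "real (\<mu> n) \<le> 3 * f (real n / 3)"
proof (induction n rule: less_induct)
  case (less n)
  show ?case
  proof (cases "n < 36")
    case True
    then show ?thesis
      using ex_three_choose_less_36 \<mu>_le_if_three_choose by blast
  next
    case False
    obtain i r where r: "r < i" and n: "n = (i choose 2) + r"
      using ex_choose_two_add by blast
    have "(Suc i choose 2) = (i choose 2) + i"
      by (simp add: numeral_2_eq_2)
    with False r n have "(9 choose 2) < (Suc i choose 2)"
      by (simp add: choose_two)
    then have i: "i \<ge> 9"
      using binomial_right_mono[of "Suc i" 9 2] by linarith
    define s where "s = sqrt (24 * real r + 9)"
    have s2: "s\<^sup>2 = 24 * real r + 9"
      by (simp add: s_def)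
    \<comment> \<open>This is where \<open>i \<ge> 9\<close> enters: for \<open>i = 8\<close>,
      \<open>r = 7\<close> it fails.\<close>
    have "24 * real r + 9 \<le> (2 * real i - 3)\<^sup>2"
    proof -
      have "9 * real i \<le> real i * real i"
        using i by (intro mult_right_mono) auto
      moreover have "(2 * real i - 3)\<^sup>2 = 4 * (real i * real i) - 12 * real i + 9"
        by (simp add: power2_eq_square algebra_simps)
      ultimately show ?thesis
        using r by linarith
    qed
    then have "s \<le> 2 * real i - 3"
      unfolding s_def using i by (intro real_le_lsqrt) auto
    then have "real i * s \<le> real i * (2 * real i - 3)"
      by (intro mult_left_mono) auto
    \<comment> \<open>The cross term \<open>4 * i * s\<close> is at most
      \<open>8 * i * i - 12 * i\<close>, which completes \<open>4 * i * i\<close> to 24 times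
      \<open>i choose 2\<close>.\<close>
    then have "(2 * real i + s)\<^sup>2 \<le> 24 * real n + 9"
      using s2 unfolding n of_nat_add real_choose_two
      by (simp add: power2_eq_square algebra_simps)
    then have "2 * real i + s \<le> sqrt (24 * real n + 9)"
      by (rule real_le_rsqrt)
    moreover have "r < n"
      using i n by simp
    then have "real (\<mu> r) \<le> (3 + s) / 2"
      using less.IH three_f_third s_def by metis
    moreover have "real (\<mu> n) \<le> real i + real (\<mu> r)"
      using \<mu>_choose_add_le[of i r] unfolding n by linarith
    ultimately show ?thesis
      unfolding three_f_third by (simp add: field_simps)
  qed
qed

theorem theorem6p6:
  fixes n :: nat
  assumes "n \<ge> 1"
  shows "real (\<mu> n) \<le> f (real n) + 3 * f ((f (real n) - 2) / 3)"
proof -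
  obtain i r where r: "r < i" and n: "n = (i choose 2) + r"
    using ex_choose_two_add by blast
  have "i \<noteq> 1"
    using assms r n by (auto simp: choose_two)
  then have i: "i \<ge> 2"
    using r by linarith
  have step: "real (\<mu> n) \<le> real i + 3 * f (real r / 3)"
    using \<mu>_choose_add_le[of i r] \<mu>_le_three_f_third[of r] unfolding n by linarith
  \<comment> \<open>If \<open>r \<le> i - 2\<close>, then \<open>i \<le> f n\<close> and
    monotonicity suffice. The extremal remainder \<open>r = i - 1\<close> needs more room.\<close>
  consider "r + 2 \<le> i" | "n = 2" | "i = r + 1" "r \<ge> 2"
  proof -
    have "n = 2" if "i = r + 1" "r < 2"
    proof -
      have "r = 1" using that i by linarith
      then show ?thesis using that n by (simp add: choose_two)
    qed
    then show ?thesis using that r by linarith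
  qed
  then show ?thesis
  proof cases
    case 1
    have "real i \<le> f (real n)"
      by (rule le_f) (simp add: n real_choose_two)
    moreover from this have "f (real r / 3) \<le> f ((f (real n) - 2) / 3)"
      using 1 by (intro f_mono) simp
    ultimately show ?thesis
      using step by linarith
  next
    case 2
    have "\<mu> 2 \<le> 4"
      using \<mu>_three_choose_le[of 2 2 0] by (simp add: choose_two numeral_2_eq_2)
    moreover have "2 \<le> f 2"
      by (rule le_f) simp
    moreover from this have "1 \<le> f ((f 2 - 2) / 3)"
      by (intro le_f) simp
    ultimately show ?thesis
      using 2 by simp
  next
    case 3
    define F where "F = f (real n)"
    \<comment> \<open>Here \<open>f n\<close> exceeds \<open>i\<close> by at least 1/2, which pays
      for a square root of \<open>24 * r + 9\<close> up to 1 larger than \<open>s\<close>.\<close>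
    have F: "real r + 3 / 2 \<le> F"
      unfolding F_def using 3(2) by (intro le_f) (simp add: n real_choose_two 3(1) algebra_simps)
    define s where "s = sqrt (24 * (F - 2) + 9)"
    have s2: "s\<^sup>2 = 24 * (F - 2) + 9"
      unfolding s_def using F 3(2) by simp
    have "6 \<le> s"
      unfolding s_def using F 3(2) by (intro real_le_rsqrt) simp
    then have "24 * real r + 9 \<le> (1 + s)\<^sup>2"
      using s2 F by (simp add: power2_eq_square algebra_simps)
    then have "sqrt (24 * real r + 9) \<le> 1 + s"
      using \<open>6 \<le> s\<close> by (intro real_le_lsqrt) auto
    then have "real i + 3 * f (real r / 3) \<le> F + 3 * f ((F - 2) / 3)"
      unfolding three_f_third s_def[symmetric] using F 3(1) by (simp add: field_simps)
    then show ?thesis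
      using step unfolding F_def by linarith
  qed
qed

end
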